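(* Let $\Phi=(G,\varphi)$ be a $\mathbb{T}$-gain graph on $n$ vertices with gain Laplacian matrix $\mathbf{L}(\Phi)$ and largest Laplacian eigenvalue $\lambda_n(\Phi)$. Then $$\lambda_n(\Phi)=\lim_{k\to\infty}\left(\max_{i\in\{1,2,\dots,n\}}\bigl(\mathbf{L}^k(\Phi)\bigr)_{ii}\right)^{\frac1k},$$ where $k$ runs over the positive integers and $(\mathbf{L}^k(\Phi))_{ii}$ is the $i$-th diagonal entry of the $k$-th power of $\mathbf{L}(\Phi)$.
   Context: A $\mathbb{T}$-gain graph (complex unit gain graph) $\Phi=(G,\varphi)$ consists of a finite simple undirected graph $G$ with vertices $v_1,\dots,v_n$ and a map $\varphi$ assigning to each oriented edge $\overrightarrow{e}_{ij}$ (from $v_i$ to $v_j$, where $v_i\sim v_j$) a complex number of modulus $1$, with $\varphi(\overrightarrow{e}_{ji})=\varphi(\overrightarrow{e}_{ij})^{-1}$. Its adjacency matrix $\mathbf{A}(\Phi)=(a_{ij})$ has $a_{ij}=\varphi(\overrightarrow{e}_{ij})$ if $v_i\sim v_j$ and $a_{ij}=0$ otherwise. The gain Laplacian is $\mathbf{L}(\Phi)=\mathbf{D}(G)-\mathbf{A}(\Phi)$, where $\mathbf{D}(G)$ is the diagonal matrix of vertex degrees of $G$; it is Hermitian positive semidefinite with eigenvalues $0\le\lambda_1(\Phi)\le\dots\le\lambda_n(\Phi)$. *)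

theory Defs
  imports
    "HOL-Analysis.Analysis"
    "Graph_Theory.Pair_Digraph"
    "Jordan_Normal_Form.Spectral_Radius"
begin

text \<open>
  A finite simple undirected graph is a \<^locale>\<open>pair_graph\<close>: a finite loop-free symmetric
  digraph without parallel arcs, each undirected edge being represented by its two orientations.
  The list \<open>vs\<close> enumerates the vertices, so that \<open>vs ! i\<close> is the vertex written $v_{i+1}$ on
  paper, and matrix rows and columns are indexed from 0 accordingly.
\<close>

locale gain_graph = pair_graph G for G :: "'a pair_pre_digraph" +
  fixes \<phi> :: "'a \<times> 'a \<Rightarrow> complex"
    and vs :: "'a list"
  assumes distinct_vs: "distinct vs"
    and set_vs: "set vs = pverts G"
    and gain_unit: "e \<in> parcs G \<Longrightarrow> cmod (\<phi> e) = 1"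
    and gain_rev: "(u, v) \<in> parcs G \<Longrightarrow> \<phi> (v, u) = inverse (\<phi> (u, v))"

definition gain_adjacency_mat ::
  "'a pair_pre_digraph \<Rightarrow> ('a \<times> 'a \<Rightarrow> complex) \<Rightarrow> 'a list \<Rightarrow> complex mat" where
  "gain_adjacency_mat G \<phi> vs = mat (length vs) (length vs)
     (\<lambda>(i, j). if (vs ! i, vs ! j) \<in> parcs G then \<phi> (vs ! i, vs ! j) else 0)"

text \<open>In a symmetric digraph the out-degree of a vertex is its degree as an undirected graph.\<close>

definition degree_mat :: "'a pair_pre_digraph \<Rightarrow> 'a list \<Rightarrow> complex mat" where
  "degree_mat G vs = mat (length vs) (length vs)
     (\<lambda>(i, j). if i = j then of_nat (out_degree (with_proj G) (vs ! i)) else 0)"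

definition gain_laplacian ::
  "'a pair_pre_digraph \<Rightarrow> ('a \<times> 'a \<Rightarrow> complex) \<Rightarrow> 'a list \<Rightarrow> complex mat" where
  "gain_laplacian G \<phi> vs = degree_mat G vs - gain_adjacency_mat G \<phi> vs"

text \<open>
  All eigenvalues of the gain Laplacian are real (lemma \<open>gain_laplacian_eigenvalue_real\<close> below),
  so nothing is lost by ranging over real eigenvalues only.
\<close>

definition largest_laplacian_eigenvalue ::
  "'a pair_pre_digraph \<Rightarrow> ('a \<times> 'a \<Rightarrow> complex) \<Rightarrow> 'a list \<Rightarrow> real" where
  "largest_laplacian_eigenvalue G \<phi> vs =
     Max {x. eigenvalue (gain_laplacian G \<phi> vs) (complex_of_real x)}"

lemma gain_laplacian_carrier [simp]:
  "gain_laplacian G \<phi> vs \<in> carrier_mat (length vs) (length vs)"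
  by (auto simp: gain_laplacian_def degree_mat_def gain_adjacency_mat_def)

context gain_graph
begin

lemma gain_laplacian_hermitian:
  assumes "i < length vs" "j < length vs"
  shows "gain_laplacian G \<phi> vs $$ (j, i) = cnj (gain_laplacian G \<phi> vs $$ (i, j))"
proof -
  have sym: "(u, v) \<in> parcs G \<Longrightarrow> (v, u) \<in> parcs G" for u v
    using pair_sym_arcs by (auto simp: symmetric_def sym_def)
  have "\<phi> (v, u) = cnj (\<phi> (u, v))" if "(u, v) \<in> parcs G" for u v
  proof -
    have "\<phi> (u, v) * cnj (\<phi> (u, v)) = 1"
      using gain_unit[OF that] by (simp add: complex_norm_square[symmetric])
    then show ?thesis
      using gain_rev[OF that] inverse_unique by metis
  qed
  from this[of "vs ! i" "vs ! j"] show ?thesis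
    using assms sym[of "vs ! i" "vs ! j"] sym[of "vs ! j" "vs ! i"]
    by (auto simp: gain_laplacian_def degree_mat_def gain_adjacency_mat_def)
qed

lemma gain_laplacian_pow_hermitian:
  assumes "i < length vs" "j < length vs"
  shows "(gain_laplacian G \<phi> vs ^\<^sub>m k) $$ (j, i) = cnj ((gain_laplacian G \<phi> vs ^\<^sub>m k) $$ (i, j))"
  using assms
proof (induction k arbitrary: i j)
  case 0
  then show ?case by (simp add: carrier_matD[OF gain_laplacian_carrier])
next
  case (Suc k)
  define A where "A = gain_laplacian G \<phi> vs"
  define n where "n = length vs"
  have A [simp]: "A \<in> carrier_mat n n" by (simp add: A_def n_def)
  have Ak: "A ^\<^sub>m k \<in> carrier_mat n n" by simp
  have herm: "A $$ (b, a) = cnj (A $$ (a, b))" if "a < n" "b < n" for a b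
    using that unfolding A_def n_def by (rule gain_laplacian_hermitian)
  have IH: "(A ^\<^sub>m k) $$ (b, a) = cnj ((A ^\<^sub>m k) $$ (a, b))" if "a < n" "b < n" for a b
    using that unfolding A_def n_def by (rule Suc.IH)
  have comm: "A ^\<^sub>m l * A = A * A ^\<^sub>m l" for l
  proof (induction l)
    case 0
    show ?case using A by (simp add: carrier_matD[OF A])
  next
    case (Suc l)
    have "A ^\<^sub>m Suc l * A = (A * A ^\<^sub>m l) * A" using Suc by simp
    also have "\<dots> = A * (A ^\<^sub>m l * A)" by (rule assoc_mult_mat[OF A _ A]) simp
    finally show ?case by simp
  qed
  have i: "i < n" and j: "j < n" using Suc.prems by (simp_all add: n_def)
  have entry: "(B * C) $$ (a, b) = (\<Sum>m<n. B $$ (a, m) * C $$ (m, b))"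
    if "B \<in> carrier_mat n n" "C \<in> carrier_mat n n" "a < n" "b < n" for B C :: "complex mat" and a b
    using that by (auto simp: scalar_prod_def atLeast0LessThan intro!: sum.cong)
  have "(A ^\<^sub>m Suc k) $$ (j, i) = (\<Sum>m<n. (A ^\<^sub>m k) $$ (j, m) * A $$ (m, i))"
    using entry[OF Ak A j i] by simp
  also have "\<dots> = (\<Sum>m<n. cnj (A $$ (i, m) * (A ^\<^sub>m k) $$ (m, j)))"
    using herm[OF i] IH[OF _ j] by (intro sum.cong) (simp_all add: mult.commute)
  also have "\<dots> = cnj ((A * A ^\<^sub>m k) $$ (i, j))"
    using entry[OF A Ak i j] by simp
  finally show ?case unfolding A_def[symmetric] by (simp add: comm)
qed

lemma gain_laplacian_pow_diag_real:
  assumes "i < length vs"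
  shows "(gain_laplacian G \<phi> vs ^\<^sub>m k) $$ (i, i) \<in> \<real>"
  using gain_laplacian_pow_hermitian[OF assms assms, of k] by (simp add: Reals_cnj_iff)

lemma gain_laplacian_eigenvalue_real:
  assumes "eigenvalue (gain_laplacian G \<phi> vs) c"
  shows "c \<in> \<real>"
proof -
  define A where "A = gain_laplacian G \<phi> vs"
  define n where "n = length vs"
  have A: "A \<in> carrier_mat n n" by (simp add: A_def n_def)
  have herm: "A $$ (b, a) = cnj (A $$ (a, b))" if "a < n" "b < n" for a b
    using that unfolding A_def n_def by (rule gain_laplacian_hermitian)
  obtain v where v: "v \<in> carrier_vec n" "v \<noteq> 0\<^sub>v n" and Av: "A *\<^sub>v v = c \<cdot>\<^sub>v v"
    using assms A unfolding eigenvalue_def eigenvector_def A_def[symmetric] by auto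
  define q where "q = (\<Sum>a<n. \<Sum>b<n. cnj (v $ a) * A $$ (a, b) * v $ b)"
  define r where "r = (\<Sum>a<n. (cmod (v $ a))\<^sup>2)"
  have row: "(\<Sum>b<n. A $$ (a, b) * v $ b) = c * v $ a" if "a < n" for a
  proof -
    have "(\<Sum>b<n. A $$ (a, b) * v $ b) = (A *\<^sub>v v) $ a"
      using that A v by (auto simp: scalar_prod_def atLeast0LessThan intro!: sum.cong)
    then show ?thesis using that v by (simp add: Av)
  qed
  have "q = (\<Sum>a<n. cnj (v $ a) * (\<Sum>b<n. A $$ (a, b) * v $ b))"
    by (simp add: q_def sum_distrib_left mult.assoc)
  also have "\<dots> = (\<Sum>a<n. c * of_real ((cmod (v $ a))\<^sup>2))"
    by (intro sum.cong) (simp_all only: row complex_norm_square lessThan_iff, simp add: mult_ac)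
  also have "\<dots> = c * of_real r" by (simp add: r_def sum_distrib_left)
  finally have q: "q = c * of_real r" .
  have "cnj q = (\<Sum>a<n. \<Sum>b<n. cnj (v $ b) * A $$ (b, a) * v $ a)"
    unfolding q_def cnj_sum
  proof (intro sum.cong refl)
    fix a b assume "a \<in> {..<n}" "b \<in> {..<n}"
    then show "cnj (cnj (v $ a) * A $$ (a, b) * v $ b) = cnj (v $ b) * A $$ (b, a) * v $ a"
      using herm[of a b] by simp
  qed
  also have "\<dots> = q" unfolding q_def by (rule sum.swap)
  finally have "q \<in> \<real>" by (simp add: Reals_cnj_iff)
  moreover have "r \<noteq> 0"
  proof
    assume "r = 0"
    then have "\<forall>a<n. v $ a = 0" unfolding r_def by (subst (asm) sum_nonneg_eq_0_iff) auto
    then have "v = 0\<^sub>v n" using v by (intro eq_vecI) auto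
    with v show False by simp
  qed
  moreover from this have "c = q / of_real r" using q by simp
  ultimately show ?thesis by (metis Reals_divide Reals_of_real)
qed

end

end

theory Submission
  imports Defs
begin

text \<open>
  The trace of \<open>A\<^sup>k\<close> is the sum of the \<open>k\<close>-th powers of the eigenvalues of \<open>A\<close>, counted with
  multiplicity. For a positive semidefinite \<open>A\<close> of size \<open>n\<close> with largest eigenvalue \<open>\<lambda>\<close> it thus
  lies between \<open>\<lambda>\<^sup>k\<close> and \<open>n * \<lambda>\<^sup>k\<close>. The powers of \<open>A\<close> being positive semidefinite as well, their
  diagonal entries are nonnegative, so the largest of them lies between the \<open>n\<close>-th part of the
  trace and the trace. Taking \<open>k\<close>-th roots removes the factors \<open>n\<close> in the limit.
\<close>

section \<open>Entrywise products, traces and eigenvalue power sums\<close>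

lemma mult_mat_sum:
  assumes "A \<in> carrier_mat n m" "B \<in> carrier_mat m l" "i < n" "j < l"
  shows "(A * B) $$ (i, j) = (\<Sum>k<m. A $$ (i, k) * B $$ (k, j))"
  using assms by (auto simp: scalar_prod_def atLeast0LessThan intro!: sum.cong)

lemma mult_mat_vec_sum:
  assumes "A \<in> carrier_mat n m" "v \<in> carrier_vec m" "i < n"
  shows "(A *\<^sub>v v) $ i = (\<Sum>k<m. A $$ (i, k) * v $ k)"
  using assms by (auto simp: scalar_prod_def atLeast0LessThan intro!: sum.cong)

lemma cscalar_prod_sum:
  fixes v w :: "complex vec"
  assumes "w \<in> carrier_vec n"
  shows "v \<bullet>c w = (\<Sum>i<n. v $ i * cnj (w $ i))"
  using assms by (auto simp: scalar_prod_def atLeast0LessThan intro!: sum.cong)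

lemma sum_diag_mult_commute:
  fixes A B :: "'a :: comm_semiring_0 mat"
  assumes A: "A \<in> carrier_mat n n" and B: "B \<in> carrier_mat n n"
  shows "(\<Sum>i<n. (A * B) $$ (i, i)) = (\<Sum>i<n. (B * A) $$ (i, i))"
proof -
  have "(\<Sum>i<n. (A * B) $$ (i, i)) = (\<Sum>i<n. \<Sum>k<n. A $$ (i, k) * B $$ (k, i))"
    by (intro sum.cong refl mult_mat_sum[OF A B]) simp_all
  also have "\<dots> = (\<Sum>k<n. \<Sum>i<n. B $$ (k, i) * A $$ (i, k))"
    by (subst sum.swap) (simp add: mult.commute)
  also have "\<dots> = (\<Sum>k<n. (B * A) $$ (k, k))"
    by (intro sum.cong refl mult_mat_sum[OF B A, symmetric]) simp_all
  finally show ?thesis .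
qed

text \<open>The trace is invariant under cyclic permutation: \<open>P\<close> moves from the front
  of \<open>P * (B * Q)\<close> to its end, where it cancels against \<open>Q\<close>.\<close>

lemma sum_diag_similar:
  fixes A B :: "'a :: comm_ring_1 mat"
  assumes A: "A \<in> carrier_mat n n" and sim: "similar_mat_wit A B P Q"
  shows "(\<Sum>i<n. A $$ (i, i)) = (\<Sum>i<n. B $$ (i, i))"
proof -
  note D = similar_mat_witD2[OF A sim]
  have "(\<Sum>i<n. A $$ (i, i)) = (\<Sum>i<n. (P * (B * Q)) $$ (i, i))"
    using D by (simp add: assoc_mult_mat[of P n n B n Q n])
  also have "\<dots> = (\<Sum>i<n. ((B * Q) * P) $$ (i, i))"
    using D by (intro sum_diag_mult_commute) auto
  also have "(B * Q) * P = B"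
    using D by (simp add: assoc_mult_mat[of B n n Q n P n])
  finally show ?thesis .
qed

text \<open>In the sum for the entry \<open>(i, j)\<close> only indices \<open>k\<close> with i
  \<le> k \<le> j can contribute: none if \<open>j < i\<close>, and just \<open>k = i\<close> if
  \<open>j = i\<close>.\<close>

lemma upper_triangular_mult:
  fixes A B :: "'a :: semiring_0 mat"
  assumes A: "A \<in> carrier_mat n n" "upper_triangular A"
    and B: "B \<in> carrier_mat n n" "upper_triangular B"
  shows "upper_triangular (A * B)"
    and "i < n \<Longrightarrow> (A * B) $$ (i, i) = A $$ (i, i) * B $$ (i, i)"
proof -
  have zero: "A $$ (i, k) * B $$ (k, j) = 0" if "i < n" "k < n" "k < i \<or> j < k" for i j k
    using that A B by (auto simp: upper_triangular_def)
  show "upper_triangular (A * B)"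
  proof
    fix i j assume ji: "j < i" and "i < dim_row (A * B)"
    then have "i < n" "j < n" using A by auto
    then have "(A * B) $$ (i, j) = (\<Sum>k<n. A $$ (i, k) * B $$ (k, j))"
      using A B by (intro mult_mat_sum)
    also have "\<dots> = 0" using ji \<open>i < n\<close> by (intro sum.neutral ballI zero) auto
    finally show "(A * B) $$ (i, j) = 0" .
  qed
  assume i: "i < n"
  then have "(A * B) $$ (i, i) = (\<Sum>k<n. A $$ (i, k) * B $$ (k, i))"
    using A B by (intro mult_mat_sum)
  also have "\<dots> = (\<Sum>k\<in>{i}. A $$ (i, k) * B $$ (k, i))"
    using i by (intro sum.mono_neutral_right ballI zero) auto
  finally show "(A * B) $$ (i, i) = A $$ (i, i) * B $$ (i, i)" by simp
qed

lemma upper_triangular_pow: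
  fixes A :: "'a :: semiring_1 mat"
  assumes A: "A \<in> carrier_mat n n" "upper_triangular A"
  shows "upper_triangular (A ^\<^sub>m k) \<and> (\<forall>i<n. (A ^\<^sub>m k) $$ (i, i) = A $$ (i, i) ^ k)"
proof (induction k)
  case 0
  then show ?case using A by auto
next
  case (Suc k)
  with A show ?case
    using upper_triangular_mult[of "A ^\<^sub>m k" n A] by (simp add: power_commutes)
qed

text \<open>The characteristic polynomial splits over the complex numbers, so Schur decomposition
  gives a similar upper triangular matrix with its roots on the diagonal. Powers stay similar and
  triangular, with the powers of the roots on the diagonal. Thus \<open>c\<close> lists the
  eigenvalues with algebraic multiplicity.\<close>

lemma sum_diag_pow_eq_sum_eigenvalues:
  fixes A :: "complex mat"
  assumes A: "A \<in> carrier_mat n n"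
  obtains c where "c ` {..<n} = spectrum A"
    and "\<And>k. (\<Sum>i<n. (A ^\<^sub>m k) $$ (i, i)) = (\<Sum>i<n. c i ^ k)"
proof -
  obtain es where es: "char_poly A = (\<Prod>a\<leftarrow>es. [:- a, 1:])" and len: "length es = n"
    using char_poly_factorized[OF A] by auto
  obtain B P Q where "schur_decomposition A es = (B, P, Q)"
    by (cases "schur_decomposition A es")
  from schur_decomposition[OF A es this]
  have sim: "similar_mat_wit A B P Q" and ut: "upper_triangular B" and diag: "diag_mat B = es"
    by auto
  have B: "B \<in> carrier_mat n n" using similar_mat_witD2[OF A sim] by simp
  have nth: "es ! i = B $$ (i, i)" if "i < n" for i
    using that B diag by (auto simp: diag_mat_def)
  have "spectrum A = set es"
    unfolding spectrum_root_char_poly[OF A] es by (auto simp: poly_prod_list prod_list_zero_iff)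
  also have "\<dots> = (!) es ` {..<n}" using len by (auto simp: set_conv_nth)
  finally have spec: "(!) es ` {..<n} = spectrum A" ..
  have "(\<Sum>i<n. (A ^\<^sub>m k) $$ (i, i)) = (\<Sum>i<n. es ! i ^ k)" for k
  proof -
    have "(\<Sum>i<n. (A ^\<^sub>m k) $$ (i, i)) = (\<Sum>i<n. (B ^\<^sub>m k) $$ (i, i))"
      using A by (intro sum_diag_similar[OF _ similar_mat_wit_pow[OF sim]]) simp
    also have "\<dots> = (\<Sum>i<n. es ! i ^ k)"
      using upper_triangular_pow[OF B ut] by (intro sum.cong) (simp_all add: nth)
    finally show ?thesis .
  qed
  with spec show ?thesis by (rule that)
qed

section \<open>Positive semidefinite matrices and their powers\<close>

lemma hermitian_cscalar_prod:
  fixes A :: "complex mat"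
  assumes A: "A \<in> carrier_mat n n"
    and herm: "\<And>i j. i < n \<Longrightarrow> j < n \<Longrightarrow> A $$ (j, i) = cnj (A $$ (i, j))"
    and v: "v \<in> carrier_vec n" and w: "w \<in> carrier_vec n"
  shows "(A *\<^sub>v v) \<bullet>c w = v \<bullet>c (A *\<^sub>v w)"
proof -
  have Aw: "A *\<^sub>v w \<in> carrier_vec n" using A w by (rule mult_mat_vec_carrier)
  have "(A *\<^sub>v v) \<bullet>c w = (\<Sum>i<n. \<Sum>k<n. A $$ (i, k) * v $ k * cnj (w $ i))"
    using mult_mat_vec_sum[OF A v]
    by (simp add: cscalar_prod_sum[OF w] sum_distrib_right del: index_mult_mat_vec)
  also have "\<dots> = (\<Sum>k<n. \<Sum>i<n. A $$ (i, k) * v $ k * cnj (w $ i))"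
    by (rule sum.swap)
  also have "\<dots> = (\<Sum>k<n. \<Sum>i<n. v $ k * cnj (A $$ (k, i) * w $ i))"
    by (intro sum.cong refl) (simp add: herm[symmetric])
  also have "\<dots> = v \<bullet>c (A *\<^sub>v w)"
    using mult_mat_vec_sum[OF A w]
    by (simp add: cscalar_prod_sum[OF Aw] sum_distrib_left del: index_mult_mat_vec)
  finally show ?thesis .
qed

text \<open>In the order on complex numbers, \<open>0 \<le> z\<close> says that \<open>z\<close> is
  real and nonnegative.\<close>

definition pos_semidef_mat :: "nat \<Rightarrow> complex mat \<Rightarrow> bool" where
  "pos_semidef_mat n A \<longleftrightarrow> A \<in> carrier_mat n n \<and>
     (\<forall>i<n. \<forall>j<n. A $$ (j, i) = cnj (A $$ (i, j))) \<and>
     (\<forall>v\<in>carrier_vec n. 0 \<le> (A *\<^sub>v v) \<bullet>c v)"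

lemma pos_semidef_matD:
  assumes "pos_semidef_mat n A"
  shows "A \<in> carrier_mat n n"
    and "i < n \<Longrightarrow> j < n \<Longrightarrow> A $$ (j, i) = cnj (A $$ (i, j))"
    and "v \<in> carrier_vec n \<Longrightarrow> 0 \<le> (A *\<^sub>v v) \<bullet>c v"
  using assms unfolding pos_semidef_mat_def by blast+

text \<open>Self-adjointness moves one factor \<open>A\<close> to the other side, so the form of the
  power \<open>k + 2\<close> at \<open>v\<close> is that of the power \<open>k\<close> at
  \<open>A *\<^sub>v v\<close>. Induction in steps of two therefore suffices, starting from the
  squared norm and the form of \<open>A\<close> itself.\<close>

lemma pos_semidef_pow_form_nonneg:
  assumes A: "pos_semidef_mat n A" and v: "v \<in> carrier_vec n"
  shows "0 \<le> (A ^\<^sub>m k *\<^sub>v v) \<bullet>c v"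
  using v
proof (induction k arbitrary: v rule: induct_nat_012)
  case 0
  then show ?case using pos_semidef_matD(1)[OF A] by auto
next
  case 1
  then show ?case using pos_semidef_matD(1,3)[OF A] by simp
next
  case (ge2 k)
  have A': "A \<in> carrier_mat n n" using A by (rule pos_semidef_matD)
  note Ak = pow_carrier_mat[OF A', of k]
  \<comment> \<open>Matrix powers unfold with the new factor on the right, whereas self-adjointness
    will be applied to a factor on the left.\<close>
  have comm: "A ^\<^sub>m Suc l *\<^sub>v w = A *\<^sub>v (A ^\<^sub>m l *\<^sub>v w)" if "w \<in> carrier_vec n" for l w
    using that
  proof (induction l arbitrary: w)
    case 0
    then show ?case using A' by auto
  next
    case (Suc l)
    have Al: "A ^\<^sub>m l \<in> carrier_mat n n" "A ^\<^sub>m Suc l \<in> carrier_mat n n" using A' by auto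
    have "A ^\<^sub>m Suc (Suc l) *\<^sub>v w = A ^\<^sub>m Suc l *\<^sub>v (A *\<^sub>v w)"
      using assoc_mult_mat_vec[OF Al(2) A' Suc.prems] by simp
    also have "\<dots> = A *\<^sub>v (A ^\<^sub>m l *\<^sub>v (A *\<^sub>v w))" using A' Suc.prems by (intro Suc.IH) simp
    also have "A ^\<^sub>m l *\<^sub>v (A *\<^sub>v w) = A ^\<^sub>m Suc l *\<^sub>v w"
      using assoc_mult_mat_vec[OF Al(1) A' Suc.prems] by simp
    finally show ?case .
  qed
  have Av: "A *\<^sub>v v \<in> carrier_vec n" using A' ge2.prems by simp
  have "A ^\<^sub>m Suc (Suc k) *\<^sub>v v = A ^\<^sub>m Suc k *\<^sub>v (A *\<^sub>v v)"
    using assoc_mult_mat_vec[OF pow_carrier_mat[OF A', of "Suc k"] A' ge2.prems] by simp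
  also have "\<dots> = A *\<^sub>v (A ^\<^sub>m k *\<^sub>v (A *\<^sub>v v))" by (rule comm[OF Av])
  finally have "(A ^\<^sub>m Suc (Suc k) *\<^sub>v v) \<bullet>c v = (A *\<^sub>v (A ^\<^sub>m k *\<^sub>v (A *\<^sub>v v))) \<bullet>c v"
    by (rule arg_cong)
  also have "\<dots> = (A ^\<^sub>m k *\<^sub>v (A *\<^sub>v v)) \<bullet>c (A *\<^sub>v v)"
    by (rule hermitian_cscalar_prod[OF A' pos_semidef_matD(2)[OF A]
          mult_mat_vec_carrier[OF Ak Av] ge2.prems])
  finally have "(A ^\<^sub>m Suc (Suc k) *\<^sub>v v) \<bullet>c v = (A ^\<^sub>m k *\<^sub>v (A *\<^sub>v v)) \<bullet>c (A *\<^sub>v v)" .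
  with ge2.IH(1)[OF Av] show ?case by simp
qed

text \<open>A diagonal entry is the value of the form at a unit vector.\<close>

lemma pos_semidef_pow_diag_nonneg:
  assumes "pos_semidef_mat n A" "i < n"
  shows "0 \<le> (A ^\<^sub>m k) $$ (i, i)"
proof -
  have Ak: "A ^\<^sub>m k \<in> carrier_mat n n"
    using pos_semidef_matD(1)[OF assms(1)] by (rule pow_carrier_mat)
  have "(A ^\<^sub>m k *\<^sub>v unit_vec n i) \<bullet>c unit_vec n i = (A ^\<^sub>m k *\<^sub>v unit_vec n i) $ i"
    using assms(2)
    by (subst cscalar_prod_sum[of _ n]) (auto simp: unit_vec_def if_distrib cong: if_cong)
  also have "\<dots> = (A ^\<^sub>m k) $$ (i, i)"
    using Ak assms(2)
    by (subst mult_mat_vec_sum[OF Ak]) (auto simp: unit_vec_def if_distrib cong: if_cong)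
  finally show ?thesis
    using pos_semidef_pow_form_nonneg[OF assms(1), of "unit_vec n i" k] by simp
qed

text \<open>At an eigenvector \<open>v\<close> the form is \<open>c\<close> times the positive
  squared norm of \<open>v\<close>.\<close>

lemma pos_semidef_eigenvalue_nonneg:
  assumes A: "pos_semidef_mat n A" and "eigenvalue A c"
  shows "0 \<le> c"
proof -
  obtain v where v: "v \<in> carrier_vec n" "v \<noteq> 0\<^sub>v n" and Av: "A *\<^sub>v v = c \<cdot>\<^sub>v v"
    using assms(2) pos_semidef_matD(1)[OF A] unfolding eigenvalue_def eigenvector_def by auto
  have "0 \<le> (A *\<^sub>v v) \<bullet>c v" using A v(1) by (rule pos_semidef_matD)
  also have "\<dots> = c * (v \<bullet>c v)" using v by (simp add: Av)
  finally have "0 \<le> c * (v \<bullet>c v)" .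
  moreover have "v \<bullet>c v > 0" using v by simp
  ultimately show ?thesis by (auto simp: less_eq_complex_def less_complex_def zero_le_mult_iff)
qed

section \<open>The limit for positive semidefinite matrices\<close>

lemma root_max_diag_pow_tendsto:
  assumes A: "pos_semidef_mat n A" and n: "n > 0"
  shows "(\<lambda>k. root k (MAX i\<in>{..<n}. Re ((A ^\<^sub>m k) $$ (i, i))))
           \<longlonglongrightarrow> Max {x. eigenvalue A (complex_of_real x)}"
proof -
  have A': "A \<in> carrier_mat n n" using A by (rule pos_semidef_matD)
  define E where "E = {x. eigenvalue A (complex_of_real x)}"
  define M where "M k = (MAX i\<in>{..<n}. Re ((A ^\<^sub>m k) $$ (i, i)))" for k
  obtain c where c: "c ` {..<n} = spectrum A"
    and tr: "\<And>k. (\<Sum>i<n. (A ^\<^sub>m k) $$ (i, i)) = (\<Sum>i<n. c i ^ k)"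
    using sum_diag_pow_eq_sum_eigenvalues[OF A'] by metis
  define x where "x i = Re (c i)" for i
  have ev: "eigenvalue A (c i)" if "i < n" for i
    using c that by (auto simp: spectrum_def)
  \<comment> \<open>Nonnegativity in the complex order includes a vanishing imaginary part, so
    passing from \<open>c\<close> to its real part \<open>x\<close> loses nothing.\<close>
  have cx: "c i = complex_of_real (x i)" and x0: "0 \<le> x i" if "i < n" for i
    using pos_semidef_eigenvalue_nonneg[OF A ev[OF that]]
    by (auto simp: x_def less_eq_complex_def complex_eq_iff)
  have E: "E = x ` {..<n}"
  proof
    show "E \<subseteq> x ` {..<n}"
    proof
      fix y assume "y \<in> E"
      then have "complex_of_real y \<in> c ` {..<n}" by (simp add: E_def c spectrum_def)
      then obtain i where "i < n" "c i = complex_of_real y" by auto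
      then have "y = x i" by (simp add: x_def)
      with \<open>i < n\<close> show "y \<in> x ` {..<n}" by simp
    qed
    show "x ` {..<n} \<subseteq> E" using ev by (auto simp: E_def cx)
  qed
  define l where "l = Max E"
  have "finite E" "E \<noteq> {}" using n by (auto simp: E)
  then have "l \<in> x ` {..<n}" unfolding l_def E[symmetric] by (rule Max_in)
  then obtain m where m: "m < n" "x m = l" by auto
  have xl: "x i \<le> l" if "i < n" for i
    using that \<open>finite E\<close> by (auto simp: l_def E)
  have l0: "0 \<le> l" using x0 m by auto
  have trace: "(\<Sum>i<n. Re ((A ^\<^sub>m k) $$ (i, i))) = (\<Sum>i<n. x i ^ k)" for k
  proof -
    have "(\<Sum>i<n. Re ((A ^\<^sub>m k) $$ (i, i))) = Re (\<Sum>i<n. c i ^ k)"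
      unfolding tr[symmetric] by simp
    also have "\<dots> = (\<Sum>i<n. x i ^ k)"
      by (simp add: cx flip: of_real_power)
    finally show ?thesis .
  qed
  have diag0: "0 \<le> Re ((A ^\<^sub>m k) $$ (i, i))" if "i < n" for i k
    using pos_semidef_pow_diag_nonneg[OF A that] by (simp add: less_eq_complex_def)
  have upper: "M k \<le> n * l ^ k" for k
  proof -
    have "M k \<le> (\<Sum>i<n. Re ((A ^\<^sub>m k) $$ (i, i)))"
      unfolding M_def using n diag0
      by (subst Max_le_iff) (auto intro!: member_le_sum)
    also have "\<dots> \<le> (\<Sum>i<n. l ^ k)"
      unfolding trace using xl x0 by (intro sum_mono power_mono) auto
    finally show ?thesis by simp
  qed
  have lower: "l ^ k / n \<le> M k" for k
  proof -
    \<comment> \<open>The summand at \<open>m\<close> is \<open>l ^ k\<close>, and the others are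
      nonnegative.\<close>
    have "l ^ k \<le> (\<Sum>i<n. x i ^ k)"
      using m x0 by (auto intro!: member_le_sum simp flip: m(2))
    also have "\<dots> \<le> (\<Sum>i<n. M k)"
      unfolding trace[symmetric] by (intro sum_mono) (auto simp: M_def)
    finally show ?thesis using n by (simp add: field_simps)
  qed
  have root_n: "(\<lambda>k. root k (real n)) \<longlonglongrightarrow> 1"
    using n by (intro LIMSEQ_root_const) simp
  have "(\<lambda>k. root k (M k)) \<longlonglongrightarrow> l"
  proof (rule tendsto_sandwich)
    \<comment> \<open>Since \<open>root 0\<close> is constantly 0, the cancellation can fail at
      \<open>k = 0\<close>; the bounds below are hence claimed only eventually.\<close>
    have root_eq: "root k (l ^ k) = l" if "k > 0" for k
      using that l0 by (rule real_root_power_cancel)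
    show "\<forall>\<^sub>F k in sequentially. l / root k n \<le> root k (M k)"
      using eventually_gt_at_top[of 0]
    proof eventually_elim
      case (elim k)
      then have "l / root k n = root k (l ^ k / n)" by (simp add: real_root_divide root_eq)
      with elim lower show ?case by simp
    qed
    show "\<forall>\<^sub>F k in sequentially. root k (M k) \<le> root k n * l"
      using eventually_gt_at_top[of 0]
    proof eventually_elim
      case (elim k)
      then have "root k n * l = root k (n * l ^ k)" by (simp add: real_root_mult root_eq)
      with elim upper show ?case by simp
    qed
    show "(\<lambda>k. l / root k n) \<longlonglongrightarrow> l"
      using tendsto_divide[OF tendsto_const[of l] root_n] by simp
    show "(\<lambda>k. root k n * l) \<longlonglongrightarrow> l"
      using tendsto_mult[OF root_n tendsto_const[of l]] by simp
  qed
  then show ?thesis by (simp add: l_def M_def E_def)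
qed

section \<open>Positive semidefiniteness of the gain Laplacian\<close>

context gain_graph
begin

text \<open>Arcs leaving a vertex correspond to the indices of their heads: injectively since
  \<open>vs\<close> is distinct, and onto since every head is a vertex and so occurs in
  \<open>vs\<close>. This turns degrees into sums over indices.\<close>

lemma out_degree_nth_eq_card:
  assumes "i < length vs"
  shows "out_degree (with_proj G) (vs ! i) = card {j. j < length vs \<and> (vs ! i, vs ! j) \<in> parcs G}"
proof -
  have "bij_betw (\<lambda>j. (vs ! i, vs ! j)) {j. j < length vs \<and> (vs ! i, vs ! j) \<in> parcs G}
          (out_arcs (with_proj G) (vs ! i))"
    unfolding bij_betw_def
  proof
    show "inj_on (\<lambda>j. (vs ! i, vs ! j)) {j. j < length vs \<and> (vs ! i, vs ! j) \<in> parcs G}"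
      using distinct_vs by (auto simp: inj_on_def nth_eq_iff_index_eq)
    have "\<exists>j<length vs. vs ! j = v" if "(u, v) \<in> parcs G" for u v
      using in_arcsD2[OF that] set_vs by (auto simp: in_set_conv_nth)
    then show "(\<lambda>j. (vs ! i, vs ! j)) ` {j. j < length vs \<and> (vs ! i, vs ! j) \<in> parcs G}
                 = out_arcs (with_proj G) (vs ! i)"
      by (fastforce simp: out_arcs_def image_iff)
  qed
  then show ?thesis by (simp add: out_degree_def bij_betw_same_card)
qed

text \<open>
  Twice the quadratic form of the gain Laplacian is the sum of \<open>|v\<^sub>i - \<phi>\<^sub>i\<^sub>j v\<^sub>j|\<^sup>2\<close> over all
  arcs \<open>(i, j)\<close>.
\<close>

lemma pos_semidef_gain_laplacian: "pos_semidef_mat (length vs) (gain_laplacian G \<phi> vs)"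
proof -
  define n where "n = length vs"
  define L where "L = gain_laplacian G \<phi> vs"
  define a where "a i j = (if (vs ! i, vs ! j) \<in> parcs G then \<phi> (vs ! i, vs ! j) else 0)" for i j
  \<comment> \<open>The 0/1 adjacency of the underlying graph, equal to the squared modulus of
    \<open>a\<close>; its row sums are the degrees.\<close>
  define e where "e i j = (if (vs ! i, vs ! j) \<in> parcs G then 1 else 0 :: complex)" for i j
  have L: "L \<in> carrier_mat n n" by (simp add: L_def n_def)
  have sym: "(u, v) \<in> parcs G \<longleftrightarrow> (v, u) \<in> parcs G" for u v
    using pair_sym_arcs by (auto simp: symmetric_def sym_def)
  have unit: "a i j * cnj (a i j) = e i j" for i j
    by (simp add: a_def e_def gain_unit flip: complex_norm_square)
  have e_swap: "e j i = e i j" for i j using sym by (simp add: e_def)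
  have a_swap: "a j i = cnj (a i j)" for i j
  proof (cases "(vs ! i, vs ! j) \<in> parcs G")
    case True
    have "\<phi> (vs ! i, vs ! j) \<noteq> 0" using gain_unit[OF True] by auto
    \<comment> \<open>On an arc, both \<open>a j i\<close> and the conjugate of \<open>a i j\<close>
      are inverse to \<open>a i j\<close>: one by the reversal rule, the other by unit
      modulus.\<close>
    then have "a i j * a j i = 1"
      using True sym[of "vs ! i" "vs ! j"] gain_rev[OF True] by (simp add: a_def)
    moreover have "a i j * cnj (a i j) = 1" using True by (simp add: unit e_def)
    ultimately show ?thesis by (metis inverse_unique)
  qed (use sym in \<open>auto simp: a_def\<close>)
  have "0 \<le> (L *\<^sub>v v) \<bullet>c v" if v: "v \<in> carrier_vec n" for v
  proof -
    define S where "S = (L *\<^sub>v v) \<bullet>c v"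
    have entry: "L $$ (i, j) = (if i = j then (\<Sum>j<n. e i j) else 0) - a i j"
      if "i < n" "j < n" for i j
    proof -
      have "(\<Sum>j<n. e i j) = of_nat (out_degree (with_proj G) (vs ! i))"
        using that unfolding n_def
        by (simp add: out_degree_nth_eq_card e_def sum.If_cases Int_def)
      moreover have "L $$ (i, j)
          = (if i = j then of_nat (out_degree (with_proj G) (vs ! i)) else 0) - a i j"
        using that
        by (simp add: L_def n_def gain_laplacian_def degree_mat_def gain_adjacency_mat_def a_def)
      ultimately show ?thesis by (simp only:)
    qed
    \<comment> \<open>The degree term is distributed over the neighbours, one copy of
      \<open>v $ i\<close> for each.\<close>
    have row: "(L *\<^sub>v v) $ i = (\<Sum>j<n. e i j * v $ i - a i j * v $ j)" if "i < n" for i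
    proof -
      have "(L *\<^sub>v v) $ i
          = (\<Sum>j<n. (if i = j then (\<Sum>j<n. e i j) * v $ j else 0) - a i j * v $ j)"
        unfolding mult_mat_vec_sum[OF L v that]
        using that by (intro sum.cong) (auto simp: entry algebra_simps)
      also have "\<dots> = (\<Sum>j<n. e i j * v $ i - a i j * v $ j)"
        using that by (simp add: sum_subtractf sum_distrib_right)
      finally show ?thesis .
    qed
    have S: "S = (\<Sum>i<n. \<Sum>j<n. (e i j * v $ i - a i j * v $ j) * cnj (v $ i))"
      unfolding S_def by (simp add: cscalar_prod_sum[OF v] row sum_distrib_right del: index_mult_mat_vec)
    \<comment> \<open>Interchanging the roles of \<open>i\<close> and \<open>j\<close> gives a
      second expression for \<open>S\<close>. Added to the first, it pairs the contributions of the
      two orientations of each edge, making every summand a square.\<close>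
    also have "\<dots> = (\<Sum>i<n. \<Sum>j<n. (e i j * v $ j - cnj (a i j) * v $ i) * cnj (v $ j))"
      by (subst sum.swap) (simp only: e_swap a_swap[symmetric])
    finally have "2 * S = (\<Sum>i<n. \<Sum>j<n. (e i j * v $ i - a i j * v $ j) * cnj (v $ i)
        + (e i j * v $ j - cnj (a i j) * v $ i) * cnj (v $ j))"
      using S by (simp add: sum.distrib)
    also have "\<dots> =
        (\<Sum>i<n. \<Sum>j<n. (e i j * v $ i - a i j * v $ j) * cnj (e i j * v $ i - a i j * v $ j))"
    proof (intro sum.cong refl)
      fix i j
      show "(e i j * v $ i - a i j * v $ j) * cnj (v $ i)
          + (e i j * v $ j - cnj (a i j) * v $ i) * cnj (v $ j)
        = (e i j * v $ i - a i j * v $ j) * cnj (e i j * v $ i - a i j * v $ j)"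
        \<comment> \<open>Off the arcs everything vanishes. On an arc \<open>e i j = 1\<close>, and
          unit modulus turns the missing \<open>v $ j * cnj (v $ j)\<close> into the last term of
          the expanded square.\<close>
        using unit[of i j]
        by (cases "(vs ! i, vs ! j) \<in> parcs G") (simp_all add: e_def a_def algebra_simps)
    qed
    also have "0 \<le> \<dots>"
      by (intro sum_nonneg conjugate_square_positive[where 'a = complex, unfolded conjugate_complex_def])
    finally show ?thesis by (simp add: S_def less_eq_complex_def)
  qed
  with L show ?thesis
    using gain_laplacian_hermitian unfolding pos_semidef_mat_def L_def n_def by blast
qed

end

theorem theorem5p2:
  fixes G :: "'a pair_pre_digraph"
    and \<phi> :: "'a \<times> 'a \<Rightarrow> complex"
    and vs :: "'a list"
  assumes "gain_graph G \<phi> vs"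
    and "length vs \<ge> 1"
  shows "(\<lambda>k. root k (MAX i\<in>{..<length vs}. Re ((gain_laplacian G \<phi> vs ^\<^sub>m k) $$ (i, i))))
           \<longlonglongrightarrow> largest_laplacian_eigenvalue G \<phi> vs"
  unfolding largest_laplacian_eigenvalue_def
  using assms(2)
  \<comment> \<open>At least one vertex is required so that both maxima range over nonempty
    sets.\<close>
  by (intro root_max_diag_pow_tendsto gain_graph.pos_semidef_gain_laplacian assms(1)) linarith

end
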